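(* Let $p\ge2$ be an integer, $\varepsilon_p=(-1)^{p-1}$, and $$\mathcal A_p(X,Y)=\operatorname{Res}_a\!\left(a^p-\varepsilon_pX,\ (1-a)^p-\varepsilon_pY\right).$$ Then the curve $\{\mathcal A_p=0\}\subset\mathbb C^2$ is rationally parametrized by $$X=\varepsilon_pa^p,\qquad Y=\varepsilon_p(1-a)^p,\qquad a\in\mathbb C.$$ In homogeneous form, with $a=s/(s+t)$ and $(z_1,z_2,z_3)=(-1,X,Y)$ on the affine chart, the parametrization is $$[s:t]\longmapsto[z_1:z_2:z_3]=[-(s+t)^p:\varepsilon_ps^p:\varepsilon_pt^p],$$ and the six anharmonic transformations $$a,\quad 1-a,\quad a^{-1},\quad (1-a)^{-1},\quad \frac{a}{a-1},\quad \frac{a-1}{a}$$ of the parameter induce on this curve the full group $S_3$ of permutations of the homogeneous coordinates $(z_1,z_2,z_3)$; in particular the projective characteristic curve is invariant under all permutations of $z_1,z_2,z_3$.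
   Context: $\operatorname{Res}_a$ is the resultant with respect to $a$. A point $(X,Y)$ of the affine plane is identified with the projective point $[-1:X:Y]\in\mathbb P^2(\mathbb C)$. *)

theory Defs
  imports "HOL-Analysis.Analysis" "HOL-Combinatorics.Perm" "Subresultants.Resultant_Prelim"
begin

section \<open>Complex projective space\<close>

definition proj_rel :: "complex ^ 'n \<Rightarrow> complex ^ 'n \<Rightarrow> bool" where
  "proj_rel v w \<longleftrightarrow> v \<noteq> 0 \<and> w \<noteq> 0 \<and> (\<exists>c. c \<noteq> 0 \<and> w = c *s v)"

lemma part_equivp_proj_rel: "part_equivp (proj_rel :: complex ^ 'n \<Rightarrow> complex ^ 'n \<Rightarrow> bool)"
proof (rule part_equivpI)
  show "\<exists>v :: complex ^ 'n. proj_rel v v"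
  proof (intro exI)
    have "(1 :: complex ^ 'n) \<noteq> 0" by (simp add: Finite_Cartesian_Product.vec_eq_iff)
    then show "proj_rel (1 :: complex ^ 'n) 1"
      unfolding proj_rel_def by (intro conjI exI[of _ 1]) auto
  qed
  show "symp (proj_rel :: complex ^ 'n \<Rightarrow> complex ^ 'n \<Rightarrow> bool)"
  proof (rule sympI)
    fix v w :: "complex ^ 'n"
    assume "proj_rel v w"
    then obtain c where "v \<noteq> 0" "w \<noteq> 0" "c \<noteq> 0" "w = c *s v"
      by (auto simp: proj_rel_def)
    then show "proj_rel w v"
      unfolding proj_rel_def by (intro conjI exI[of _ "inverse c"]) (auto simp: vector_smult_assoc)
  qed
  show "transp (proj_rel :: complex ^ 'n \<Rightarrow> complex ^ 'n \<Rightarrow> bool)"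
  proof (rule transpI)
    fix u v w :: "complex ^ 'n"
    assume "proj_rel u v" "proj_rel v w"
    then obtain c d where "u \<noteq> 0" "w \<noteq> 0" "c \<noteq> 0" "d \<noteq> 0" "v = c *s u" "w = d *s v"
      by (auto simp: proj_rel_def)
    then show "proj_rel u w"
      unfolding proj_rel_def by (intro conjI exI[of _ "d * c"]) (auto simp: vector_smult_assoc)
  qed
qed

quotient_type 'n proj = "complex ^ 'n" / partial: proj_rel
  morphisms hcoords hpoint
  by (rule part_equivp_proj_rel)

text \<open>
  \<open>hpoint v\<close> is the point with homogeneous coordinates \<open>v\<close>; it is meaningful only for
  \<open>v \<noteq> 0\<close>. Thus \<^typ>\<open>2 proj\<close> is the projective line and \<^typ>\<open>3 proj\<close> the projective plane.
\<close>

lemma hpoint_eq_iff: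
  assumes "v \<noteq> 0" "w \<noteq> 0"
  shows "hpoint v = hpoint w \<longleftrightarrow> (\<exists>c. c \<noteq> 0 \<and> w = c *s v)"
proof -
  have "proj_rel x x" if "x \<noteq> 0" for x :: "complex ^ 'a"
    using that unfolding proj_rel_def by (intro conjI exI[of _ 1]) auto
  then have "proj_rel v w \<longleftrightarrow> hpoint v = hpoint w"
    using Quotient3_rel[OF Quotient3_proj, of v w] assms by blast
  then show ?thesis using assms by (auto simp: proj_rel_def)
qed

text \<open>The left action of permutations of the index type on homogeneous coordinates.\<close>

lift_definition permute_coords :: "'n perm \<Rightarrow> 'n::finite proj \<Rightarrow> 'n proj" is
  "\<lambda>\<sigma> v. \<chi> i. vec_nth v (Perm.apply (inverse \<sigma>) i)"
proof -
  fix \<sigma> :: "'n perm" and v w :: "complex ^ 'n"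
  assume "proj_rel v w"
  moreover have "(\<chi> i. vec_nth u (Perm.apply (inverse \<sigma>) i)) \<noteq> 0" if u: "u \<noteq> 0" for u :: "complex ^ 'n"
  proof
    assume eq: "(\<chi> i. vec_nth u (Perm.apply (inverse \<sigma>) i)) = 0"
    have "vec_nth u j = 0" for j
    proof -
      have "vec_nth u (Perm.apply (inverse \<sigma>) (Perm.apply \<sigma> j)) = 0"
        using eq by (auto simp: Finite_Cartesian_Product.vec_eq_iff)
      moreover have "Perm.apply (inverse \<sigma>) (Perm.apply \<sigma> j) = j"
        by (simp add: Perm.apply_sequence perm.left_inverse)
      ultimately show ?thesis by (simp only:)
    qed
    with u show False by (simp add: Finite_Cartesian_Product.vec_eq_iff)
  qed
  ultimately show "proj_rel (\<chi> i. vec_nth v (Perm.apply (inverse \<sigma>) i)) (\<chi> i. vec_nth w (Perm.apply (inverse \<sigma>) i))"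
    unfolding proj_rel_def by (auto simp: Finite_Cartesian_Product.vec_eq_iff)
qed


section \<open>Bivariate polynomials and their projective zero sets\<close>

text \<open>
  A polynomial in \<open>X, Y\<close> is an element of \<open>\<complex>[X][Y]\<close>: the outer variable is \<open>Y\<close>, and the
  coefficient of \<open>X^i Y^j\<close> in \<open>q\<close> is \<open>coeff (coeff q j) i\<close>.
\<close>

definition var_X :: "complex poly poly" where "var_X = [:[:0, 1:]:]"

definition var_Y :: "complex poly poly" where "var_Y = [:0, 1:]"

definition eval2 :: "complex poly poly \<Rightarrow> complex \<Rightarrow> complex \<Rightarrow> complex" where
  "eval2 q x y = poly (poly q [:y:]) x"

definition total_degree :: "complex poly poly \<Rightarrow> nat" where
  "total_degree q = Max (insert 0 {i + j | i j. coeff (coeff q j) i \<noteq> 0})"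

text \<open>
  The homogenization for the affine chart \<open>(X, Y) \<mapsto> [-1 : X : Y]\<close>, that is
  \<open>(-z\<^sub>1)^d q (- z\<^sub>2 / z\<^sub>1, - z\<^sub>3 / z\<^sub>1)\<close> with \<open>d\<close> the total degree of \<open>q\<close>.
\<close>

definition homogenization :: "complex poly poly \<Rightarrow> complex ^ 3 \<Rightarrow> complex" where
  "homogenization q z =
     (\<Sum>j\<le>degree q. \<Sum>i\<le>degree (coeff q j).
        coeff (coeff q j) i * (- vec_nth z 1) ^ (total_degree q - (i + j))
          * vec_nth z 2 ^ i * vec_nth z 3 ^ j)"

lemma homogenization_chart: "homogenization q (vector [-1, x, y]) = eval2 q x y"
proof -
  have "eval2 q x y = (\<Sum>j\<le>degree q. poly (coeff q j) x * y ^ j)"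
    by (simp add: eval2_def poly_altdef[of q] poly_sum)
  also have "\<dots> = (\<Sum>j\<le>degree q. \<Sum>i\<le>degree (coeff q j). coeff (coeff q j) i * x ^ i * y ^ j)"
    by (simp add: poly_altdef[of "coeff q _"] sum_distrib_right)
  finally show ?thesis by (simp add: homogenization_def)
qed


section \<open>The characteristic curve and its parametrization\<close>

definition eps :: "nat \<Rightarrow> 'a::comm_ring_1" where "eps p = (-1) ^ (p - 1)"

text \<open>The outermost polynomial variable, with respect to which the resultant is taken, is \<open>a\<close>.\<close>

definition char_polynomial :: "nat \<Rightarrow> complex poly poly" where
  "char_polynomial p =
     resultant ([:0, 1:] ^ p - [:eps p * var_X:]) ((1 - [:0, 1:]) ^ p - [:eps p * var_Y:])"

definition affine_curve :: "nat \<Rightarrow> (complex \<times> complex) set" where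
  "affine_curve p = {(x, y). eval2 (char_polynomial p) x y = 0}"

definition projective_curve :: "nat \<Rightarrow> 3 proj set" where
  "projective_curve p = {hpoint z | z. z \<noteq> 0 \<and> homogenization (char_polynomial p) z = 0}"

definition param_X :: "nat \<Rightarrow> complex \<Rightarrow> complex" where "param_X p a = eps p * a ^ p"

definition param_Y :: "nat \<Rightarrow> complex \<Rightarrow> complex" where "param_Y p a = eps p * (1 - a) ^ p"

definition hom_param_coords :: "nat \<Rightarrow> complex \<Rightarrow> complex \<Rightarrow> complex ^ 3" where
  "hom_param_coords p s t = vector [- ((s + t) ^ p), eps p * s ^ p, eps p * t ^ p]"

lemma hom_param_coords_nonzero: "s \<noteq> 0 \<or> t \<noteq> 0 \<Longrightarrow> hom_param_coords p s t \<noteq> 0"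
  by (auto simp: hom_param_coords_def Finite_Cartesian_Product.vec_eq_iff forall_3 eps_def)

lift_definition hom_param :: "nat \<Rightarrow> 2 proj \<Rightarrow> 3 proj" is
  "\<lambda>p v. hom_param_coords p (vec_nth v 1) (vec_nth v 2)"
proof -
  fix p and v w :: "complex ^ 2"
  assume "proj_rel v w"
  then obtain c where c: "v \<noteq> 0" "w \<noteq> 0" "c \<noteq> 0" "w = c *s v"
    by (auto simp: proj_rel_def)
  have "hom_param_coords p (c * vec_nth v 1) (c * vec_nth v 2)
      = (c ^ p) *s hom_param_coords p (vec_nth v 1) (vec_nth v 2)"
    by (simp add: hom_param_coords_def Finite_Cartesian_Product.vec_eq_iff forall_3 power_mult_distrib
        flip: distrib_left)
  then show "proj_rel (hom_param_coords p (vec_nth v 1) (vec_nth v 2))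
      (hom_param_coords p (vec_nth w 1) (vec_nth w 2))"
    using c hom_param_coords_nonzero[of "vec_nth v 1" "vec_nth v 2" p]
      hom_param_coords_nonzero[of "vec_nth w 1" "vec_nth w 2" p]
    unfolding proj_rel_def
    by (intro conjI exI[of _ "c ^ p"]) (auto simp: Finite_Cartesian_Product.vec_eq_iff forall_2)
qed


section \<open>Fractional linear transformations of the parameter\<close>

text \<open>
  The parameter is the coordinate \<open>a = s / (s + t)\<close> on the projective line, so \<open>(s, s + t)\<close> are
  homogeneous coordinates (numerator, denominator) for \<open>a\<close>. The map \<open>mobius \<alpha> \<beta> \<gamma> \<delta>\<close> is
  \<open>a \<mapsto> (\<alpha> a + \<beta>) / (\<gamma> a + \<delta>)\<close>, extended to the whole line including \<open>a = \<infinity>\<close>, i.e. \<open>[1 : -1]\<close>.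
  For a singular matrix it is a dummy, namely the identity.
\<close>

lift_definition mobius :: "complex \<Rightarrow> complex \<Rightarrow> complex \<Rightarrow> complex \<Rightarrow> 2 proj \<Rightarrow> 2 proj" is
  "\<lambda>\<alpha> \<beta> \<gamma> \<delta> v.
     if \<alpha> * \<delta> - \<beta> * \<gamma> = 0 then v
     else let s = vec_nth v 1; t = vec_nth v 2;
              num = \<alpha> * s + \<beta> * (s + t); den = \<gamma> * s + \<delta> * (s + t)
          in vector [num, den - num]"
proof -
  fix \<alpha> \<beta> \<gamma> \<delta> and v w :: "complex ^ 2"
  let ?f = "\<lambda>v :: complex ^ 2. if \<alpha> * \<delta> - \<beta> * \<gamma> = 0 then v
     else let s = vec_nth v 1; t = vec_nth v 2;
              num = \<alpha> * s + \<beta> * (s + t); den = \<gamma> * s + \<delta> * (s + t)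
          in vector [num, den - num]"
  assume "proj_rel v w"
  then obtain c where c: "v \<noteq> 0" "w \<noteq> 0" "c \<noteq> 0" "w = c *s v"
    by (auto simp: proj_rel_def)
  have nz: "?f u \<noteq> 0" if "u \<noteq> 0" for u
  proof (cases "\<alpha> * \<delta> - \<beta> * \<gamma> = 0")
    case False
    define n where "n = \<alpha> * vec_nth u 1 + \<beta> * (vec_nth u 1 + vec_nth u 2)"
    define d where "d = \<gamma> * vec_nth u 1 + \<delta> * (vec_nth u 1 + vec_nth u 2)"
    have 1: "\<delta> * n - \<beta> * d = (\<alpha> * \<delta> - \<beta> * \<gamma>) * vec_nth u 1"
      by (simp add: n_def d_def algebra_simps)
    have 2: "\<alpha> * d - \<gamma> * n = (\<alpha> * \<delta> - \<beta> * \<gamma>) * (vec_nth u 1 + vec_nth u 2)"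
      by (simp add: n_def d_def algebra_simps)
    have "\<not> (n = 0 \<and> d = 0)"
      using 1 2 False that by (auto simp: Finite_Cartesian_Product.vec_eq_iff forall_2)
    then show ?thesis
      using False by (auto simp: Finite_Cartesian_Product.vec_eq_iff forall_2 Let_def simp flip: n_def d_def)
  qed (use that in auto)
  have "?f (c *s v) = c *s ?f v"
    by (simp add: Finite_Cartesian_Product.vec_eq_iff forall_2 Let_def algebra_simps)
  with c nz[of v] nz[of w] show "proj_rel (?f v) (?f w)"
    unfolding proj_rel_def by blast
qed

lemma mobius_affine:
  assumes "\<alpha> * \<delta> - \<beta> * \<gamma> \<noteq> 0" "\<gamma> * a + \<delta> \<noteq> 0" "b = (\<alpha> * a + \<beta>) / (\<gamma> * a + \<delta>)"
  shows "mobius \<alpha> \<beta> \<gamma> \<delta> (hpoint (vector [a, 1 - a])) = hpoint (vector [b, 1 - b])"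
proof -
  let ?d = "\<gamma> * a + \<delta>"
  let ?v = "vector [\<alpha> * a + \<beta>, ?d - (\<alpha> * a + \<beta>)] :: complex ^ 2"
  have nz: "(vector [x, 1 - x] :: complex ^ 2) \<noteq> 0" for x
    by (auto simp: Finite_Cartesian_Product.vec_eq_iff forall_2)
  have "proj_rel (vector [a, 1 - a]) (vector [a, 1 - a] :: complex ^ 2)"
    unfolding proj_rel_def using nz by (intro conjI exI[of _ 1]) auto
  then have "mobius \<alpha> \<beta> \<gamma> \<delta> (hpoint (vector [a, 1 - a])) = hpoint ?v"
    using assms(1) by (simp add: mobius.abs_eq Let_def)
  moreover have "?v = ?d *s vector [b, 1 - b]"
    using assms(2,3) by (simp add: Finite_Cartesian_Product.vec_eq_iff forall_2 field_simps)
  moreover from this have "?v \<noteq> 0"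
    using assms(2) nz[of b] by (metis vector_mul_eq_0)
  ultimately show ?thesis
    using hpoint_eq_iff[of "vector [b, 1 - b]" ?v] nz assms(2) by metis
qed

text \<open>In order: \<open>a\<close>, \<open>1 - a\<close>, \<open>1 / a\<close>, \<open>1 / (1 - a)\<close>, \<open>a / (a - 1)\<close>, \<open>(a - 1) / a\<close>.\<close>

definition anharmonic :: "(2 proj \<Rightarrow> 2 proj) set" where
  "anharmonic = {mobius 1 0 0 1, mobius (-1) 1 0 1, mobius 0 1 1 0,
                 mobius 0 1 (-1) 1, mobius 1 0 1 (-1), mobius 1 (-1) 1 0}"

end

(*
  Put R(w, c, d) = Res_a (a^p - c, (w - a)^p - d).  It is weighted homogeneous,
  R(k w, k^p c, k^p d) = k^(p^2) R(w, c, d), and vanishes iff c = a^p and d = (w - a)^p for some a.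
  Comparing it for w -> 0 with the homogenization F of the characteristic polynomial shows that the
  latter has total degree p and F(-w^p, x, y) = R(w, eps x, eps y).  Hence the zeros of F,
  including those at infinity, are exactly the points (-(s+t)^p, eps s^p, eps t^p).

  Up to the common factor eps these are the p-th powers of the coordinates of u = (-(s+t), s, t).
  So the parameter line is the plane u_1 + u_2 + u_3 = 0 modulo scalars, S_3 acts on it by permuting
  the u_i, and the parametrization is equivariant.  In the coordinate a = s / (s+t) this action is
  the anharmonic group.  It is faithful because the curve has, for each i, a point whose i-th
  coordinate is its only zero coordinate.
*)

theory Submission
  imports Defs "Subresultants.Subresultant_Gcd"
    "HOL-Computational_Algebra.Field_as_Ring" "HOL-Computational_Algebra.Fundamental_Theorem_Algebra"
begin

section \<open>The resultant of two shifted powers\<close>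

text \<open>The roots of \<open>f'\<close> and \<open>g'\<close> are those of \<open>f\<close> and \<open>g\<close> multiplied by \<open>k\<close>.\<close>

lemma resultant_scale_roots:
  fixes f g f' g' :: "'a::idom poly"
  assumes "k \<noteq> 0"
    and "degree f = m" "degree f' = m" "\<And>i. i \<le> m \<Longrightarrow> coeff f' i = k ^ (m - i) * coeff f i"
    and "degree g = n" "degree g' = n" "\<And>i. i \<le> n \<Longrightarrow> coeff g' i = k ^ (n - i) * coeff g i"
  shows "resultant f' g' = k ^ (m * n) * resultant f g"
proof -
  \<comment> \<open>\<open>r i\<close> is the shift of the coefficients in row \<open>i\<close>: the
    first \<open>n\<close> rows come from \<open>f\<close>, the others from
    \<open>g\<close>.\<close>
  define r where "r i = (if i < n then i else i - n)" for i
  let ?S = "sylvester_mat f g" and ?S' = "sylvester_mat f' g'" and ?I = "{0..<m + n}"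
  \<comment> \<open>\<open>S'\<close> arises from \<open>S\<close> by scaling row \<open>i\<close> with \<open>k\<close> to the power \<open>- r i\<close> and column \<open>j\<close>
    with \<open>k ^ j\<close>.\<close>
  have entry: "k ^ r i * ?S' $$ (i, j) = k ^ j * ?S $$ (i, j)" if "i < m + n" "j < m + n" for i j
  proof -
    have *: "k ^ r i * (k ^ (j - r i) * z) = k ^ j * z" if "r i \<le> j" for z
      using that by (metis le_add_diff_inverse mult.assoc power_add)
    show ?thesis
    proof (cases "i < n")
      case True
      then show ?thesis
        using that assms(2-7) *[of "coeff f (m + i - j)"]
        by (auto simp: sylvester_index_mat r_def)
    next
      case False
      then have "n - (i - j) = j - r i" if "i - n \<le> j" "j \<le> i"
        using that by (simp add: r_def)
      then show ?thesis
        using False that assms(2-7) *[of "coeff g (i - j)"]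
        by (auto simp: sylvester_index_mat r_def)
    qed
  qed
  \<comment> \<open>The exponent \<open>m * n\<close> is the surplus of the column scalings over the
    row scalings: each of the \<open>m\<close> rows of \<open>g\<close> contributes
    \<open>n\<close>.\<close>
  have sum_r: "(\<Sum>i\<in>?I. i) = (\<Sum>i\<in>?I. r i) + m * n"
  proof -
    have "(\<Sum>i\<in>?I. r i) + m * n = (\<Sum>i\<in>{0..<n} \<union> {n..<n + m}. r i) + m * n"
      by (simp add: ivl_disj_un add.commute)
    also have "\<dots> = (\<Sum>i\<in>{0..<n}. i) + ((\<Sum>i\<in>{n..<n + m}. i - n) + (\<Sum>i\<in>{n..<n + m}. n))"
      by (subst sum.union_disjoint) (auto simp: r_def)
    also have "(\<Sum>i\<in>{n..<n + m}. i - n) + (\<Sum>i\<in>{n..<n + m}. n) = (\<Sum>i\<in>{n..<n + m}. i)"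
      by (subst sum.distrib[symmetric]) (rule sum.cong, auto)
    also have "(\<Sum>i\<in>{0..<n}. i) + \<dots> = (\<Sum>i\<in>{0..<n} \<union> {n..<n + m}. i)"
      by (subst sum.union_disjoint) auto
    finally show ?thesis by (simp add: ivl_disj_un add.commute)
  qed
  have det: "Determinant.det M = (\<Sum>\<pi> | \<pi> permutes ?I. signof \<pi> * (\<Prod>i\<in>?I. M $$ (i, \<pi> i)))"
    if "M \<in> carrier_mat (m + n) (m + n)" for M :: "'a mat"
    using det_def'[OF that] .
  have carrier: "?S \<in> carrier_mat (m + n) (m + n)" "?S' \<in> carrier_mat (m + n) (m + n)"
    using assms(2,3,5,6) sylvester_carrier_mat by metis+
  \<comment> \<open>Each Leibniz term takes one entry from every row and column, so all terms are
    rescaled by the same factors.\<close>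
  have prod: "(\<Prod>i\<in>?I. k ^ r i) * (\<Prod>i\<in>?I. ?S' $$ (i, \<pi> i)) = (\<Prod>i\<in>?I. k ^ i) * (\<Prod>i\<in>?I. ?S $$ (i, \<pi> i))"
    if "\<pi> permutes ?I" for \<pi>
  proof -
    have "(\<Prod>i\<in>?I. k ^ r i) * (\<Prod>i\<in>?I. ?S' $$ (i, \<pi> i)) = (\<Prod>i\<in>?I. k ^ \<pi> i * ?S $$ (i, \<pi> i))"
      unfolding prod.distrib[symmetric]
      using permutes_in_image[OF that] by (intro prod.cong refl entry) auto
    also have "\<dots> = (\<Prod>i\<in>?I. k ^ \<pi> i) * (\<Prod>i\<in>?I. ?S $$ (i, \<pi> i))"
      by (simp add: prod.distrib)
    also have "(\<Prod>i\<in>?I. k ^ \<pi> i) = (\<Prod>i\<in>?I. k ^ i)"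
      using prod.permute[OF that, of "\<lambda>i. k ^ i"] by (simp add: comp_def)
    finally show ?thesis .
  qed
  have "(\<Prod>i\<in>?I. k ^ r i) * resultant f' g' = (\<Prod>i\<in>?I. k ^ i) * resultant f g"
    unfolding resultant_def det[OF carrier(1)] det[OF carrier(2)] sum_distrib_left
    by (intro sum.cong refl) (use prod in \<open>simp add: mult.left_commute\<close>)
  then have "k ^ (\<Sum>i\<in>?I. r i) * resultant f' g' = k ^ (\<Sum>i\<in>?I. r i) * (k ^ (m * n) * resultant f g)"
    by (simp add: power_sum[symmetric] sum_r power_add)
  then show ?thesis
    using assms(1) by simp
qed

text \<open>This is \<open>R\<close> over an arbitrary integral domain: C[X][Y] for the
  characteristic polynomial, C[w] for continuity in \<open>w\<close>, and C for values.\<close>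

definition power_resultant :: "nat \<Rightarrow> 'a::idom \<Rightarrow> 'a \<Rightarrow> 'a \<Rightarrow> 'a" where
  "power_resultant p w c d = resultant ([:0, 1:] ^ p - [:c:]) ([:w, -1:] ^ p - [:d:])"

lemma degree_linear_power_minus_const:
  fixes c d w :: "'a::idom"
  assumes "p > 0" "c \<noteq> 0"
  shows "degree ([:w, c:] ^ p - [:d:]) = p"
proof -
  have "degree ([:w, c:] ^ p) = p"
    using assms by (simp add: degree_power_eq)
  then show ?thesis
    using assms(1) degree_add_eq_left[of "- [:d:]" "[:w, c:] ^ p"]
    by (simp del: minus_pCons)
qed

text \<open>The leading coefficients are powers of 1 and -1, so the homomorphism preserves both
  degrees, and with them the shape of the Sylvester matrix.\<close>

lemma (in idom_hom) hom_power_resultant: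
  assumes "p > 0"
  shows "hom (power_resultant p w c d) = power_resultant p (hom w) (hom c) (hom d)"
proof -
  interpret map_poly_hom: map_poly_idom_hom hom ..
  have "map_poly hom ([:v, u:] ^ p - [:e:]) = [:hom v, hom u:] ^ p - [:hom e:]" for u v e
    by (simp add: map_poly_hom.hom_minus map_poly_hom.hom_power map_poly_pCons_hom)
  then show ?thesis
    using assms unfolding power_resultant_def
    by (subst resultant_map_poly[symmetric])
      (simp_all add: degree_linear_power_minus_const hom_minus hom_zero hom_one hom_uminus del: pCons_one)
qed

text \<open>The substitution multiplies the roots of both polynomials by \<open>k\<close>; both
  degrees are \<open>p\<close>, whence the exponent \<open>p * p\<close>.\<close>

lemma power_resultant_scale:
  fixes k :: "'a::idom"
  assumes "p > 0" "k \<noteq> 0"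
  shows "power_resultant p (k * w) (k ^ p * c) (k ^ p * d) = k ^ (p * p) * power_resultant p w c d"
proof -
  have *: "coeff ([:k * v, u:] ^ p - [:k ^ p * e:]) i = k ^ (p - i) * coeff ([:v, u:] ^ p - [:e:]) i"
    if "i \<le> p" for i u v e
    using that
    by (cases i) (simp_all add: coeff_linear_power algebra_simps coeff_linear_poly_power power_mult_distrib)
  show ?thesis
    unfolding power_resultant_def
    using assms *[of _ 0 1 c] *[of _ w "-1" d]
    by (intro resultant_scale_roots)
      (simp_all add: degree_linear_power_minus_const del: coeff_diff pCons_one)
qed

text \<open>The resultant vanishes iff the gcd is nonconstant, which over an algebraically closed
  field means a common root.\<close>

lemma power_resultant_eq_0_iff:
  fixes w c d :: complex
  assumes "p > 0"
  shows "power_resultant p w c d = 0 \<longleftrightarrow> (\<exists>a. a ^ p = c \<and> (w - a) ^ p = d)"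
proof -
  let ?f = "[:0, 1:] ^ p - [:c:]" and ?g = "[:w, -1:] ^ p - [:d:]"
  \<comment> \<open>This keeps the gcd nonzero: the zero polynomial has degree 0 and yet has
    roots.\<close>
  have "?f \<noteq> 0"
    using degree_linear_power_minus_const[OF assms, of 1 0 c] assms by auto
  then have nz: "gcd ?f ?g \<noteq> 0" by simp
  have "degree (gcd ?f ?g) \<noteq> 0 \<longleftrightarrow> (\<exists>a. poly (gcd ?f ?g) a = 0)"
  proof
    assume "degree (gcd ?f ?g) \<noteq> 0"
    then show "\<exists>a. poly (gcd ?f ?g) a = 0"
      by (intro fundamental_theorem_of_algebra) (simp only: constant_degree not_False_eq_True)
  next
    assume "\<exists>a. poly (gcd ?f ?g) a = 0"
    then obtain a where root: "poly (gcd ?f ?g) a = 0" by blast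
    show "degree (gcd ?f ?g) \<noteq> 0"
    proof
      assume "degree (gcd ?f ?g) = 0"
      then obtain e where "gcd ?f ?g = [:e:]" by (rule degree_eq_zeroE)
      with root nz show False by (simp only: poly_pCons poly_0) simp
    qed
  qed
  also have "\<dots> \<longleftrightarrow> (\<exists>a. poly ?f a = 0 \<and> poly ?g a = 0)"
    by (simp only: poly_eq_0_iff_dvd gcd_greatest_iff)
  finally show ?thesis
    by (simp add: power_resultant_def resultant_0_gcd)
qed

section \<open>Values of the characteristic polynomial\<close>

lemma idom_hom_eval2: "idom_hom (\<lambda>q. eval2 q x y)"
  by unfold_locales (simp_all add: eval2_def)

lemma one_minus_linear: "1 - [:0, 1:] = [:1, - 1 :: 'a::comm_ring_1:]"
  by (simp flip: pCons_one)

text \<open>The definition is the case \<open>w = 1\<close> of \<open>R\<close> over C[X][Y], and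
  evaluation at a point is a ring homomorphism.\<close>

lemma eval2_char_polynomial:
  assumes "p > 0"
  shows "eval2 (char_polynomial p) x y = power_resultant p 1 (eps p * x) (eps p * y)"
proof -
  have "char_polynomial p = power_resultant p 1 (eps p * var_X) (eps p * var_Y)"
    by (simp only: char_polynomial_def power_resultant_def one_minus_linear)
  moreover have "eval2 (eps p * var_X) x y = eps p * x" "eval2 (eps p * var_Y) x y = eps p * y" "eval2 1 x y = 1"
    by (simp_all add: eps_def eval2_def var_X_def var_Y_def)
  ultimately show ?thesis
    using idom_hom.hom_power_resultant[OF idom_hom_eval2[of x y] assms] by (simp only:)
qed

section \<open>Homogenization\<close>

lemma finite_support2: "finite {(i, j). coeff (coeff q j) i \<noteq> 0}"
proof (rule finite_subset)
  show "{(i, j). coeff (coeff q j) i \<noteq> 0} \<subseteq> (\<Union>j\<le>degree q. {..degree (coeff q j)} \<times> {j})"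
    by (auto intro!: le_degree)
qed simp

lemma finite_total_degrees: "finite {i + j | i j. coeff (coeff q j) i \<noteq> 0}"
proof -
  have "{i + j | i j. coeff (coeff q j) i \<noteq> 0} = (\<lambda>(i, j). i + j) ` {(i, j). coeff (coeff q j) i \<noteq> 0}"
    by auto
  then show ?thesis using finite_support2[of q] by simp
qed

lemma le_total_degree: "coeff (coeff q j) i \<noteq> 0 \<Longrightarrow> i + j \<le> total_degree q"
  unfolding total_degree_def using finite_total_degrees[of q] by (intro Max_ge) auto

lemma total_degree_attained:
  assumes "q \<noteq> 0"
  obtains i j where "coeff (coeff q j) i \<noteq> 0" "i + j = total_degree q"
proof -
  let ?D = "{i + j | i j. coeff (coeff q j) i \<noteq> 0}"
  obtain i j where ij: "coeff (coeff q j) i \<noteq> 0"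
    using assms by (metis leading_coeff_0_iff)
  then have "?D \<noteq> {}" by blast
  then have "Max ?D \<in> ?D"
    by (rule Max_in[OF finite_total_degrees])
  \<comment> \<open>For a nonempty set of naturals the inserted 0 does not change the
    maximum.\<close>
  moreover have "total_degree q = Max ?D"
    using \<open>?D \<noteq> {}\<close> finite_total_degrees[of q] by (simp add: total_degree_def)
  ultimately have "total_degree q \<in> ?D" by (simp only:)
  then show thesis using that by auto
qed

lemma homogenization_scale: "homogenization q (c *s z) = c ^ total_degree q * homogenization q z"
proof -
  have "coeff (coeff q j) i * (- vec_nth (c *s z) 1) ^ (total_degree q - (i + j))
        * vec_nth (c *s z) 2 ^ i * vec_nth (c *s z) 3 ^ j
     = c ^ total_degree q * (coeff (coeff q j) i * (- vec_nth z 1) ^ (total_degree q - (i + j))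
        * vec_nth z 2 ^ i * vec_nth z 3 ^ j)"
    for i j
  proof (cases "coeff (coeff q j) i = 0")
    case False
    \<comment> \<open>A nonzero coefficient has \<open>i + j\<close> at most the total degree, so
      the subtraction is not truncated.\<close>
    then have "total_degree q = total_degree q - (i + j) + i + j"
      using le_total_degree[of q j i] by linarith
    then have "c ^ total_degree q = c ^ (total_degree q - (i + j)) * c ^ i * c ^ j"
      by (metis power_add)
    moreover have "(- (c * vec_nth z 1)) ^ n = c ^ n * (- vec_nth z 1) ^ n" for n
      by (metis mult_minus_right power_mult_distrib)
    ultimately show ?thesis
      by (simp add: power_mult_distrib ac_simps)
  qed simp
  then show ?thesis
    by (simp only: homogenization_def sum_distrib_left)
qed

lemma homogenization_dehomogenize:
  assumes "w \<noteq> 0"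
  shows "homogenization q (vector [- w, x, y]) = w ^ total_degree q * eval2 q (x / w) (y / w)"
proof -
  have "vector [- w, x, y] = w *s (vector [- 1, x / w, y / w] :: complex ^ 3)"
    using assms by (simp add: Finite_Cartesian_Product.vec_eq_iff forall_3)
  then show ?thesis
    by (simp only: homogenization_scale homogenization_chart)
qed

text \<open>At infinity only the top-degree form of \<open>q\<close> survives, and setting its first
  variable to 1 keeps its monomials apart.\<close>

lemma homogenization_at_infinity_nonzero:
  assumes "q \<noteq> 0"
  shows "\<exists>y. homogenization q (vector [0, 1, y]) \<noteq> 0"
proof -
  define c where "c j = (\<Sum>i\<le>degree (coeff q j). coeff (coeff q j) i * 0 ^ (total_degree q - (i + j)))" for j
  define P where "P = (\<Sum>j\<le>degree q. monom (c j) j)"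
  have "homogenization q (vector [0, 1, y]) = poly P y" for y
    by (simp add: homogenization_def P_def c_def poly_sum poly_monom sum_distrib_right)
  moreover obtain i j where ij: "coeff (coeff q j) i \<noteq> 0" "i + j = total_degree q"
    using total_degree_attained[OF assms] .
  have "c j = coeff (coeff q j) i"
  proof -
    \<comment> \<open>Since \<open>0 ^ 0 = 1\<close>, the powers of 0 select total degree exactly
      \<open>total_degree q\<close>; for fixed \<open>j\<close> this leaves the single index
      \<open>i\<close>.\<close>
    have "c j = (\<Sum>i'\<le>degree (coeff q j). if i' = i then coeff (coeff q j) i' else 0)"
      unfolding c_def
    proof (rule sum.cong)
      fix i'
      show "coeff (coeff q j) i' * 0 ^ (total_degree q - (i' + j)) = (if i' = i then coeff (coeff q j) i' else 0)"
        using ij le_total_degree[of q j i'] by (cases "coeff (coeff q j) i' = 0") auto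
    qed simp
    also have "\<dots> = coeff (coeff q j) i"
      using ij le_degree by (simp add: sum.delta)
    finally show ?thesis .
  qed
  then have "coeff P j \<noteq> 0"
    using ij by (auto simp: P_def coeff_sum intro!: le_degree)
  then have "P \<noteq> 0" by auto
  ultimately show ?thesis
    using poly_all_0_iff_0[of P] by auto
qed

section \<open>The homogenized characteristic polynomial as a resultant\<close>

lemma continuous_homogenization: "isCont (\<lambda>w. homogenization q (vector [- (w ^ p), x, y])) a"
  unfolding homogenization_def by (simp del: minus_power_mult_self)

text \<open>Extends to \<open>w = 0\<close> identities found by dividing by powers of
  \<open>w\<close>; \<open>perfect_space\<close> makes \<open>a\<close> a limit of other
  points.\<close>

lemma isCont_eq_at:
  fixes f g :: "'a::{t2_space, perfect_space} \<Rightarrow> 'b::t2_space"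
  assumes "isCont f a" "isCont g a" "\<And>w. w \<noteq> a \<Longrightarrow> f w = g w"
  shows "f a = g a"
proof (rule LIM_unique)
  show "f \<midarrow>a\<rightarrow> f a" using assms(1) by (simp add: isCont_def)
  show "f \<midarrow>a\<rightarrow> g a"
    using assms(2,3) by (metis (mono_tags, lifting) LIM_equal isCont_def)
qed

lemma eps_mult_eps: "eps p * eps p = 1"
  by (simp add: eps_def flip: power_mult_distrib)

text \<open>For nonzero \<open>w\<close> both sides agree up to a power of \<open>w\<close>. The
  limit at 0 forces that power to be trivial and then settles the points at infinity.\<close>

lemma homogenization_char_polynomial:
  assumes "p > 0"
  shows "homogenization (char_polynomial p) (vector [- (w ^ p), x, y])
    = power_resultant p w (eps p * x) (eps p * y)"
proof -
  let ?F = "\<lambda>w x y. homogenization (char_polynomial p) (vector [- (w ^ p), x, y])"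
  let ?R = "\<lambda>w x y :: complex. power_resultant p w (eps p * x) (eps p * y)"
  let ?d = "total_degree (char_polynomial p)"
  have contF: "isCont (\<lambda>w. ?F w x y) 0" for x y
    by (rule continuous_homogenization)
  have contR: "isCont (\<lambda>w. ?R w x y) 0" for x y
  proof -
    \<comment> \<open>Formed over C[w], the resultant exhibits \<open>?R\<close> as a polynomial
      function of \<open>w\<close>.\<close>
    have "idom_hom (\<lambda>q :: complex poly. poly q w)" for w
      by unfold_locales simp_all
    from idom_hom.hom_power_resultant[OF this assms, where w = "[:0, 1:]" and c = "[:eps p * x:]" and d = "[:eps p * y:]"]
    have "?R w x y = poly (power_resultant p [:0, 1:] [:eps p * x:] [:eps p * y:]) w" for w
      by simp
    then show ?thesis by (simp only: poly_isCont)
  qed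
  \<comment> \<open>Scaling by \<open>w\<close> in \<open>R\<close> and by \<open>w ^ p\<close> in
    the homogenization reduces both to the value of the characteristic polynomial at
    \<open>(x / w ^ p, y / w ^ p)\<close>.\<close>
  have FR: "w ^ (p * p) * ?F w x y = w ^ (p * ?d) * ?R w x y" if "w \<noteq> 0" for w x y
  proof -
    have "?R w x y = w ^ (p * p) * eval2 (char_polynomial p) (x / w ^ p) (y / w ^ p)"
      using power_resultant_scale[OF assms that, of 1 "eps p * (x / w ^ p)" "eps p * (y / w ^ p)"] that
      by (simp add: eval2_char_polynomial[OF assms])
    then show ?thesis
      using that by (simp add: homogenization_dehomogenize power_mult)
  qed
  \<comment> \<open>A common root would satisfy \<open>a ^ p = eps p\<close> and
    \<open>(- a) ^ p = 0\<close> at once.\<close>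
  have R_nonzero: "?R 0 1 0 \<noteq> 0"
    using assms by (auto simp: power_resultant_eq_0_iff eps_def power_0_left)
  have nz: "char_polynomial p \<noteq> 0"
  proof
    assume "char_polynomial p = 0"
    then have "power_resultant p 1 (eps p * 0) (eps p * 0) = (0 :: complex)"
      using eval2_char_polynomial[OF assms, of 0 0] by (simp add: eval2_def)
    then show False
      using assms by (simp add: power_resultant_eq_0_iff)
  qed
  have "?d = p"
  proof (rule linorder_cases)
    \<comment> \<open>At \<open>w = 0\<close> the left side below would vanish, but
      \<open>?R 0 1 0\<close> does not.\<close>
    assume less: "?d < p"
    have "w ^ (p * (p - ?d)) * ?F w 1 0 = ?R w 1 0" if "w \<noteq> 0" for w
    proof -
      have "p * p = p * ?d + p * (p - ?d)"
        using less by (simp add: distrib_left[symmetric])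
      then show ?thesis using FR[OF that, of 1 0] that by (simp add: power_add)
    qed
    then have "0 ^ (p * (p - ?d)) * ?F 0 1 0 = ?R 0 1 0"
      using contF contR[of 1 0]
      by (intro isCont_eq_at[of 0 "\<lambda>w. w ^ (p * (p - ?d)) * ?F w 1 0" "\<lambda>w. ?R w 1 0"])
        (auto intro!: continuous_intros)
    then show ?thesis using R_nonzero less assms by (simp add: power_0_left)
  next
    \<comment> \<open>Here the homogenization would vanish at all points \<open>[0 : 1 : y]\<close>,
      contrary to its top-degree form being nonzero.\<close>
    assume greater: "p < ?d"
    have "?F w 1 y = w ^ (p * (?d - p)) * ?R w 1 y" if "w \<noteq> 0" for w y
    proof -
      have "p * ?d = p * p + p * (?d - p)"
        using greater by (simp add: distrib_left[symmetric])
      then show ?thesis using FR[OF that, of 1 y] that by (simp add: power_add)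
    qed
    then have "?F 0 1 y = 0 ^ (p * (?d - p)) * ?R 0 1 y" for y
      using contF contR[of 1 y]
      by (intro isCont_eq_at[of 0 "\<lambda>w. ?F w 1 y" "\<lambda>w. w ^ (p * (?d - p)) * ?R w 1 y"])
        (auto intro!: continuous_intros)
    then have "homogenization (char_polynomial p) (vector [0, 1, y]) = 0" for y
      using greater assms by (simp add: power_0_left)
    with homogenization_at_infinity_nonzero[OF nz] show ?thesis by blast
  qed
  then have "?F w x y = ?R w x y" if "w \<noteq> 0" for w
    using FR[OF that, of x y] that by simp
  then show ?thesis
    using isCont_eq_at[OF contF contR] by (cases "w = 0") auto
qed

text \<open>Every complex number is a \<open>p\<close>-th power, so each \<open>z\<close>, at
  infinity or not, has the form treated before; a common root \<open>a\<close> gives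
  \<open>s = a\<close> and \<open>t = w - a\<close>.\<close>

lemma homogenization_char_polynomial_eq_0_iff:
  assumes "p > 0"
  shows "homogenization (char_polynomial p) z = 0 \<longleftrightarrow> (\<exists>s t. z = hom_param_coords p s t)"
proof
  assume zero: "homogenization (char_polynomial p) z = 0"
  obtain w where w: "- vec_nth z 1 = w ^ p"
    using exists_complex_root[of p "- vec_nth z 1"] assms by auto
  then have "z = vector [- (w ^ p), vec_nth z 2, vec_nth z 3]"
    by (simp add: Finite_Cartesian_Product.vec_eq_iff forall_3 flip: w)
  then obtain a where "a ^ p = eps p * vec_nth z 2" "(w - a) ^ p = eps p * vec_nth z 3"
    using zero homogenization_char_polynomial[OF assms] power_resultant_eq_0_iff[OF assms] by metis
  then have "z = hom_param_coords p a (w - a)"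
    by (simp add: hom_param_coords_def Finite_Cartesian_Product.vec_eq_iff forall_3 flip: w mult.assoc)
      (simp add: eps_mult_eps)
  then show "\<exists>s t. z = hom_param_coords p s t" by blast
next
  assume "\<exists>s t. z = hom_param_coords p s t"
  then obtain s t where z: "z = hom_param_coords p s t" by blast
  have "power_resultant p (s + t) (s ^ p) (t ^ p) = 0"
    unfolding power_resultant_eq_0_iff[OF assms] by (rule exI[of _ s]) simp
  then show "homogenization (char_polynomial p) z = 0"
    unfolding z hom_param_coords_def homogenization_char_polynomial[OF assms]
    by (simp add: eps_mult_eps flip: mult.assoc)
qed

section \<open>The action of the symmetric group\<close>

lemma proj_cases:
  obtains v where "v \<noteq> 0" "P = hpoint v"
proof -
  have "proj_rel (hcoords P) (hcoords P)"
    using Quotient3_rep_reflp[OF Quotient3_proj] .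
  moreover have "hpoint (hcoords P) = P"
    using Quotient3_abs_rep[OF Quotient3_proj] .
  ultimately show thesis
    using that[of "hcoords P"] by (simp add: proj_rel_def)
qed

lemma proj_rel_refl: "v \<noteq> 0 \<Longrightarrow> proj_rel v v"
  unfolding proj_rel_def by (intro conjI exI[of _ 1]) auto

text \<open>On a finite type each bijection has finite support, so \<open>perm\<close> contains
  every permutation. This counts the elements of S_3.\<close>

lemma card_perm: "card (UNIV :: 'a::finite perm set) = fact (CARD('a))"
proof -
  have "range Perm.apply = {f :: 'a \<Rightarrow> 'a. bij f \<and> finite {a. f a \<noteq> a}}"
    by (rule type_definition.Rep_range[OF type_definition_perm])
  then have "range (Perm.apply :: 'a perm \<Rightarrow> _) = {f. f permutes UNIV}"
    by (simp add: permutes_univ bij_iff)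
  moreover have "inj (Perm.apply :: 'a perm \<Rightarrow> _)"
    by (simp add: inj_on_def Perm.apply_inject)
  ultimately show ?thesis
    using card_permutations[of "UNIV :: 'a set"] card_image[of "Perm.apply :: 'a perm \<Rightarrow> _" UNIV] by simp
qed

definition permute_vec :: "'n perm \<Rightarrow> 'b ^ 'n \<Rightarrow> 'b ^ 'n::finite" where
  "permute_vec \<sigma> v = (\<chi> i. vec_nth v (Perm.apply (inverse \<sigma>) i))"

lemma permute_vec_one: "permute_vec 1 v = v"
  by (simp add: permute_vec_def Finite_Cartesian_Product.vec_eq_iff perm.inverse_neutral)

lemma permute_vec_times: "permute_vec (\<sigma> * \<tau>) v = permute_vec \<sigma> (permute_vec \<tau> v)"
  by (simp add: permute_vec_def Finite_Cartesian_Product.vec_eq_iff apply_times)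

lemma permute_vec_eq_0_iff: "permute_vec \<sigma> v = 0 \<longleftrightarrow> v = 0"
proof
  assume "permute_vec \<sigma> v = 0"
  then have "permute_vec (inverse \<sigma>) (permute_vec \<sigma> v) = 0"
    by (simp add: permute_vec_def Finite_Cartesian_Product.vec_eq_iff)
  then show "v = 0"
    by (simp add: permute_vec_one flip: permute_vec_times)
qed (simp add: permute_vec_def Finite_Cartesian_Product.vec_eq_iff)

lemma permute_vec_scale: "permute_vec \<sigma> (c *s v) = c *s permute_vec \<sigma> v"
  by (simp add: permute_vec_def Finite_Cartesian_Product.vec_eq_iff)

lemma sum_permute_vec: "(\<Sum>i\<in>UNIV. vec_nth (permute_vec \<sigma> v) i) = (\<Sum>i\<in>UNIV. vec_nth v i)"
  unfolding permute_vec_def vec_lambda_beta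
  by (rule sum.reindex_bij_betw) (rule bij_apply)

lemma permute_coords_hpoint: "v \<noteq> 0 \<Longrightarrow> permute_coords \<sigma> (hpoint v) = hpoint (permute_vec \<sigma> v)"
  by (simp add: permute_coords.abs_eq proj_rel_refl permute_vec_def)

section \<open>The symmetric group on the parameter line\<close>

definition sum_zero_coords :: "complex ^ 2 \<Rightarrow> complex ^ 3" where
  "sum_zero_coords v = vector [- (vec_nth v 1 + vec_nth v 2), vec_nth v 1, vec_nth v 2]"

text \<open>Inverse of \<open>sum_zero_coords\<close> on the plane of coordinate sum zero.\<close>

definition line_coords :: "complex ^ 3 \<Rightarrow> complex ^ 2" where
  "line_coords u = vector [vec_nth u 2, vec_nth u 3]"

lemma line_coords_sum_zero_coords: "line_coords (sum_zero_coords v) = v"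
  by (simp add: line_coords_def sum_zero_coords_def Finite_Cartesian_Product.vec_eq_iff forall_2)

lemma sum_zero_coords_line_coords:
  assumes "(\<Sum>i\<in>UNIV. vec_nth u i) = 0"
  shows "sum_zero_coords (line_coords u) = u"
proof -
  have "vec_nth u 1 = - (vec_nth u 2 + vec_nth u 3)"
    using assms by (simp add: sum_3 eq_neg_iff_add_eq_0 add.assoc del: minus_add_distrib)
  then show ?thesis
    by (simp add: line_coords_def sum_zero_coords_def Finite_Cartesian_Product.vec_eq_iff forall_3)
qed

lemma sum_sum_zero_coords: "(\<Sum>i\<in>UNIV. vec_nth (sum_zero_coords v) i) = 0"
  by (simp add: sum_zero_coords_def sum_3)

lemma sum_zero_coords_eq_0_iff: "sum_zero_coords v = 0 \<longleftrightarrow> v = 0"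
  by (auto simp: sum_zero_coords_def Finite_Cartesian_Product.vec_eq_iff forall_2 forall_3)

definition permute_line_vec :: "3 perm \<Rightarrow> complex ^ 2 \<Rightarrow> complex ^ 2" where
  "permute_line_vec \<sigma> v = line_coords (permute_vec \<sigma> (sum_zero_coords v))"

text \<open>Permutations preserve the coordinate sum, so the permuted vector stays in the plane and
  is recovered from its last two coordinates.\<close>

lemma sum_zero_coords_permute_line_vec:
  "sum_zero_coords (permute_line_vec \<sigma> v) = permute_vec \<sigma> (sum_zero_coords v)"
  by (simp add: permute_line_vec_def sum_zero_coords_line_coords sum_permute_vec sum_sum_zero_coords)

lemma permute_line_vec_eq_0_iff: "permute_line_vec \<sigma> v = 0 \<longleftrightarrow> v = 0"
  by (metis sum_zero_coords_permute_line_vec sum_zero_coords_eq_0_iff permute_vec_eq_0_iff)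

lemma permute_line_vec_scale: "permute_line_vec \<sigma> (c *s v) = c *s permute_line_vec \<sigma> v"
proof -
  have "sum_zero_coords (c *s v) = c *s sum_zero_coords v"
    by (simp add: sum_zero_coords_def Finite_Cartesian_Product.vec_eq_iff forall_3 algebra_simps)
  then have "permute_line_vec \<sigma> (c *s v) = line_coords (c *s permute_vec \<sigma> (sum_zero_coords v))"
    by (simp only: permute_line_vec_def permute_vec_scale)
  then show ?thesis
    by (simp add: permute_line_vec_def line_coords_def Finite_Cartesian_Product.vec_eq_iff forall_2)
qed

lift_definition permute_line :: "3 perm \<Rightarrow> 2 proj \<Rightarrow> 2 proj" is permute_line_vec
  unfolding proj_rel_def by (auto simp: permute_line_vec_eq_0_iff permute_line_vec_scale)

lemma permute_line_hpoint: "v \<noteq> 0 \<Longrightarrow> permute_line \<sigma> (hpoint v) = hpoint (permute_line_vec \<sigma> v)"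
  by (simp add: permute_line.abs_eq proj_rel_refl)

lemma permute_line_times: "permute_line (\<sigma> * \<tau>) = permute_line \<sigma> \<circ> permute_line \<tau>"
proof
  fix Q :: "2 proj"
  obtain v where "v \<noteq> 0" "Q = hpoint v" by (rule proj_cases)
  moreover have "permute_line_vec (\<sigma> * \<tau>) v = permute_line_vec \<sigma> (permute_line_vec \<tau> v)"
    by (simp add: permute_line_vec_def permute_vec_times sum_zero_coords_permute_line_vec[unfolded permute_line_vec_def])
  ultimately show "permute_line (\<sigma> * \<tau>) Q = (permute_line \<sigma> \<circ> permute_line \<tau>) Q"
    by (simp add: permute_line_hpoint permute_line_vec_eq_0_iff)
qed

lemma permute_line_one: "permute_line 1 = id"
proof
  fix Q :: "2 proj"
  obtain v where "v \<noteq> 0" "Q = hpoint v" by (rule proj_cases)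
  then show "permute_line 1 Q = id Q"
    by (simp add: permute_line_hpoint permute_line_vec_def permute_vec_one line_coords_sum_zero_coords)
qed

lemma surj_permute_line: "surj (permute_line \<sigma>)"
proof (rule surjI)
  show "permute_line \<sigma> (permute_line (inverse \<sigma>) Q) = Q" for Q
    using permute_line_times[of \<sigma> "inverse \<sigma>"] by (simp add: permute_line_one fun_eq_iff)
qed

section \<open>Equivariance and faithfulness\<close>

lemma hom_param_hpoint:
  "v \<noteq> 0 \<Longrightarrow> hom_param p (hpoint v) = hpoint (hom_param_coords p (vec_nth v 1) (vec_nth v 2))"
  by (simp add: hom_param.abs_eq proj_rel_refl)

text \<open>Because \<open>eps p * (-1) ^ p = -1\<close>, the first coordinate has the same shape as
  the other two, which makes the symmetry visible.\<close>

lemma hom_param_coords_eq_powers: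
  assumes "p > 0"
  shows "hom_param_coords p (vec_nth v 1) (vec_nth v 2) = (\<chi> i. eps p * vec_nth (sum_zero_coords v) i ^ p)"
proof -
  have "eps p * (- a) ^ p = - (a ^ p)" for a :: complex
    using assms by (cases p) (simp_all add: eps_def power_minus[of a] flip: power_add mult.assoc mult_2)
  from this[of "vec_nth v 1 + vec_nth v 2"] show ?thesis
    by (simp add: hom_param_coords_def sum_zero_coords_def Finite_Cartesian_Product.vec_eq_iff forall_3)
qed

text \<open>Taking \<open>p\<close>-th powers and multiplying by a constant act coordinatewise,
  hence commute with permutations.\<close>

lemma hom_param_permute_line:
  assumes "p > 0"
  shows "hom_param p (permute_line \<sigma> Q) = permute_coords \<sigma> (hom_param p Q)"
proof -
  obtain v where v: "v \<noteq> 0" "Q = hpoint v" by (rule proj_cases)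
  let ?z = "hom_param_coords p (vec_nth v 1) (vec_nth v 2)"
  let ?w = "permute_line_vec \<sigma> v"
  have "?z \<noteq> 0"
    using v(1) by (intro hom_param_coords_nonzero) (auto simp: Finite_Cartesian_Product.vec_eq_iff forall_2)
  moreover have "permute_vec \<sigma> ?z = hom_param_coords p (vec_nth ?w 1) (vec_nth ?w 2)"
    by (simp add: hom_param_coords_eq_powers[OF assms] sum_zero_coords_permute_line_vec)
      (simp add: permute_vec_def)
  ultimately show ?thesis
    using v by (simp add: permute_line_hpoint hom_param_hpoint permute_coords_hpoint permute_line_vec_eq_0_iff)
qed

text \<open>A point with exactly one zero coordinate shows where a permutation sends that index,
  since proportional vectors vanish in the same places.\<close>

lemma permute_coords_faithful_on_hom_param:
  assumes "p > 0" "\<And>Q. permute_coords \<sigma> (hom_param p Q) = permute_coords \<tau> (hom_param p Q)"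
  shows "\<sigma> = \<tau>"
proof -
  have "Perm.apply (inverse \<sigma>) i = k \<longleftrightarrow> Perm.apply (inverse \<tau>) i = k" for i k
  proof -
    \<comment> \<open>The witnesses for \<open>k\<close> = 1, 2, 3 are the parameters
      \<open>a\<close> = \<infinity>, 0, 1.\<close>
    have "\<exists>v. v \<noteq> 0 \<and> (\<forall>j. vec_nth (sum_zero_coords v) j = 0 \<longleftrightarrow> j = k)"
    proof -
      consider "k = 1" | "k = 2" | "k = 3" using exhaust_3 by blast
      then show ?thesis
      proof cases
        case 1
        show ?thesis
          by (rule exI[of _ "vector [1, -1]"])
            (simp add: 1 sum_zero_coords_def Finite_Cartesian_Product.vec_eq_iff forall_2 forall_3)
      next
        case 2
        show ?thesis
          by (rule exI[of _ "vector [0, 1]"])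
            (simp add: 2 sum_zero_coords_def Finite_Cartesian_Product.vec_eq_iff forall_2 forall_3)
      next
        case 3
        show ?thesis
          by (rule exI[of _ "vector [1, 0]"])
            (simp add: 3 sum_zero_coords_def Finite_Cartesian_Product.vec_eq_iff forall_2 forall_3)
      qed
    qed
    then obtain v where v: "v \<noteq> 0" "\<And>j. vec_nth (sum_zero_coords v) j = 0 \<longleftrightarrow> j = k" by blast
    define z where "z = hom_param_coords p (vec_nth v 1) (vec_nth v 2)"
    have zk: "vec_nth z j = 0 \<longleftrightarrow> j = k" for j
      using assms(1) v(2) by (simp add: z_def hom_param_coords_eq_powers eps_def)
    have z: "z \<noteq> 0"
      unfolding z_def using v(1) by (intro hom_param_coords_nonzero) (auto simp: Finite_Cartesian_Product.vec_eq_iff forall_2)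
    have "hpoint (permute_vec \<sigma> z) = hpoint (permute_vec \<tau> z)"
      using assms(2)[of "hpoint v"] v(1) z by (simp add: hom_param_hpoint permute_coords_hpoint z_def)
    then obtain c where "c \<noteq> 0" "permute_vec \<tau> z = c *s permute_vec \<sigma> z"
      using z by (auto simp: hpoint_eq_iff permute_vec_eq_0_iff)
    then have "vec_nth z (Perm.apply (inverse \<tau>) i) = c * vec_nth z (Perm.apply (inverse \<sigma>) i)"
      by (simp add: permute_vec_def Finite_Cartesian_Product.vec_eq_iff)
    with \<open>c \<noteq> 0\<close> zk show ?thesis by (metis mult_eq_0_iff)
  qed
  then have "inverse \<sigma> = inverse \<tau>" by (metis perm_eqI)
  then show ?thesis by (metis perm.inverse_inverse)
qed

text \<open>The claim is independent of the exponent, so faithfulness may be taken from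
  \<open>p = 1\<close>, where the curve is a straight line.\<close>

lemma inj_permute_line: "inj permute_line"
proof (rule injI)
  fix \<sigma> \<tau> assume "permute_line \<sigma> = permute_line \<tau>"
  then have "permute_coords \<sigma> (hom_param 1 Q) = permute_coords \<tau> (hom_param 1 Q)" for Q
    by (simp flip: hom_param_permute_line)
  then show "\<sigma> = \<tau>"
    by (rule permute_coords_faithful_on_hom_param[rotated]) simp
qed

section \<open>Identification with the anharmonic group\<close>

lemma permute_line_eq_mobius:
  assumes "\<alpha> * \<delta> - \<beta> * \<gamma> \<noteq> 0" "c \<noteq> 0"
    and "\<And>s t. \<alpha> * s + \<beta> * (s + t) = c * vec_nth (permute_line_vec \<sigma> (vector [s, t])) 1"
    and "\<And>s t. (\<gamma> * s + \<delta> * (s + t)) - (\<alpha> * s + \<beta> * (s + t)) = c * vec_nth (permute_line_vec \<sigma> (vector [s, t])) 2"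
  shows "permute_line \<sigma> = mobius \<alpha> \<beta> \<gamma> \<delta>"
proof
  fix Q :: "2 proj"
  obtain v where v: "v \<noteq> 0" "Q = hpoint v" by (rule proj_cases)
  define s t where "s = vec_nth v 1" and "t = vec_nth v 2"
  then have st: "v = vector [s, t]"
    by (simp add: Finite_Cartesian_Product.vec_eq_iff forall_2)
  let ?w = "permute_line_vec \<sigma> v"
  have "mobius \<alpha> \<beta> \<gamma> \<delta> Q = hpoint (c *s ?w)"
  proof -
    \<comment> \<open>Linear maps that agree up to the scalar \<open>c\<close> induce the same
      projective map.\<close>
    have "vector [\<alpha> * s + \<beta> * (s + t), (\<gamma> * s + \<delta> * (s + t)) - (\<alpha> * s + \<beta> * (s + t))] = c *s ?w"
      using assms(3,4) by (simp only: Finite_Cartesian_Product.vec_eq_iff forall_2 vector_2 vector_smult_component st)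
    then show ?thesis
      unfolding v(2) mobius.abs_eq[OF proj_rel_refl[OF v(1)]]
      using assms(1) by (simp add: Let_def st)
  qed
  also have "\<dots> = hpoint ?w"
  proof -
    have "?w \<noteq> 0" using v by (simp add: permute_line_vec_eq_0_iff)
    then show ?thesis
      using assms(2) hpoint_eq_iff[of ?w "c *s ?w"] by (auto simp: vector_mul_eq_0)
  qed
  finally show "permute_line \<sigma> Q = mobius \<alpha> \<beta> \<gamma> \<delta> Q"
    using v by (simp add: permute_line_hpoint)
qed

text \<open>A permutation of three indices is determined by the preimages \<open>j\<close> and
  \<open>k\<close> of 2 and 3, which leaves six cases.\<close>

lemma permute_line_in_anharmonic: "permute_line \<sigma> \<in> anharmonic"
proof -
  define j k where "j = Perm.apply (inverse \<sigma>) 2" and "k = Perm.apply (inverse \<sigma>) 3"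
  have eq: "permute_line_vec \<sigma> v = vector [vec_nth (sum_zero_coords v) j, vec_nth (sum_zero_coords v) k]" for v
    by (simp add: permute_line_vec_def line_coords_def permute_vec_def j_def k_def)
  note rule = permute_line_eq_mobius[where \<sigma> = \<sigma>, unfolded eq]
  have "j \<noteq> k"
    by (simp add: j_def k_def apply_inj)
  then consider "j = 2" "k = 3" | "j = 3" "k = 2" | "j = 1" "k = 3" | "j = 1" "k = 2" | "j = 2" "k = 1" | "j = 3" "k = 1"
    using exhaust_3[of j] exhaust_3[of k] by metis
  then show ?thesis
  proof cases
    case 1
    \<comment> \<open>The value given to \<open>rule\<close> is \<open>c\<close>; it is -1 in the
      cases where the listed matrix yields the negative of the permuted coordinates.\<close>
    have "permute_line \<sigma> = mobius 1 0 0 1"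
      by (rule rule[of _ _ _ _ 1]) (simp_all add: 1 sum_zero_coords_def)
    then show ?thesis by (simp add: anharmonic_def)
  next
    case 2
    have "permute_line \<sigma> = mobius (- 1) 1 0 1"
      by (rule rule[of _ _ _ _ 1]) (simp_all add: 2 sum_zero_coords_def)
    then show ?thesis by (simp add: anharmonic_def)
  next
    case 3
    have "permute_line \<sigma> = mobius 0 1 1 0"
      by (rule rule[of _ _ _ _ "-1"]) (simp_all add: 3 sum_zero_coords_def)
    then show ?thesis by (simp add: anharmonic_def)
  next
    case 4
    have "permute_line \<sigma> = mobius 0 1 (- 1) 1"
      by (rule rule[of _ _ _ _ "-1"]) (simp_all add: 4 sum_zero_coords_def)
    then show ?thesis by (simp add: anharmonic_def)
  next
    case 5
    have "permute_line \<sigma> = mobius 1 0 1 (- 1)"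
      by (rule rule[of _ _ _ _ 1]) (simp_all add: 5 sum_zero_coords_def)
    then show ?thesis by (simp add: anharmonic_def)
  next
    case 6
    have "permute_line \<sigma> = mobius 1 (- 1) 1 0"
      by (rule rule[of _ _ _ _ "-1"]) (simp_all add: 6 sum_zero_coords_def)
    then show ?thesis by (simp add: anharmonic_def)
  qed
qed

text \<open>Six distinct images lie in a set listed with six entries, so counting also shows that
  the listed maps are distinct.\<close>

lemma range_permute_line: "range permute_line = anharmonic"
proof (rule card_subset_eq)
  show "finite anharmonic" by (simp add: anharmonic_def)
  show "range permute_line \<subseteq> anharmonic" using permute_line_in_anharmonic by blast
  have "card (range permute_line) = 6"
    using card_image[OF inj_permute_line] by (simp add: card_perm fact_numeral)
  moreover have "card anharmonic \<le> 6"
    by (simp add: anharmonic_def card_insert_if)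
  ultimately show "card (range permute_line) = card anharmonic"
    using card_mono[OF \<open>finite anharmonic\<close> \<open>range permute_line \<subseteq> anharmonic\<close>] by simp
qed

section \<open>The curve as the image of its parametrization\<close>

text \<open>Homogeneity makes vanishing independent of the representative.\<close>

lemma hpoint_in_projective_curve_iff:
  assumes "z \<noteq> 0"
  shows "hpoint z \<in> projective_curve p \<longleftrightarrow> homogenization (char_polynomial p) z = 0"
proof
  assume "hpoint z \<in> projective_curve p"
  then obtain z' where z': "hpoint z = hpoint z'" "z' \<noteq> 0" "homogenization (char_polynomial p) z' = 0"
    by (auto simp: projective_curve_def)
  then obtain c where "c \<noteq> 0" "z' = c *s z"
    using assms by (auto simp: hpoint_eq_iff)
  with z'(3) show "homogenization (char_polynomial p) z = 0"
    by (simp add: homogenization_scale)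
qed (use assms in \<open>auto simp: projective_curve_def\<close>)

lemma affine_curve_eq_range:
  assumes "p > 0"
  shows "affine_curve p = range (\<lambda>a. (param_X p a, param_Y p a))"
proof -
  have eps_cancel: "a = eps p * b \<longleftrightarrow> b = eps p * a" for a b :: complex
    using eps_mult_eps[of p] by (metis mult.assoc mult_1)
  have "(x, y) \<in> affine_curve p \<longleftrightarrow> (\<exists>a. x = param_X p a \<and> y = param_Y p a)" for x y
    by (simp add: affine_curve_def eval2_char_polynomial[OF assms] power_resultant_eq_0_iff[OF assms]
        param_X_def param_Y_def eps_cancel[of "_ ^ p"])
  then show ?thesis by auto
qed

lemma projective_curve_eq_range:
  assumes "p > 0"
  shows "projective_curve p = range (hom_param p)"
proof (intro equalityI subsetI)
  fix P assume "P \<in> projective_curve p"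
  then obtain z where z: "P = hpoint z" "z \<noteq> 0" "homogenization (char_polynomial p) z = 0"
    by (auto simp: projective_curve_def)
  then obtain s t where st: "z = hom_param_coords p s t"
    using homogenization_char_polynomial_eq_0_iff[OF assms] by blast
  with \<open>z \<noteq> 0\<close> have "(vector [s, t] :: complex ^ 2) \<noteq> 0"
    using assms by (auto simp: hom_param_coords_def Finite_Cartesian_Product.vec_eq_iff forall_2 forall_3)
  then have "P = hom_param p (hpoint (vector [s, t]))"
    by (simp add: z(1) st hom_param_hpoint)
  then show "P \<in> range (hom_param p)" by blast
next
  fix P assume "P \<in> range (hom_param p)"
  then obtain Q where "P = hom_param p Q" by blast
  moreover obtain v where v: "v \<noteq> 0" "Q = hpoint v" by (rule proj_cases)
  moreover have "hom_param_coords p (vec_nth v 1) (vec_nth v 2) \<noteq> 0"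
    using v(1) by (intro hom_param_coords_nonzero) (auto simp: Finite_Cartesian_Product.vec_eq_iff forall_2)
  ultimately show "P \<in> projective_curve p"
    using homogenization_char_polynomial_eq_0_iff[OF assms]
    by (auto simp: hom_param_hpoint hpoint_in_projective_curve_iff)
qed

text \<open>Generic injectivity of the parametrization: equal values force
  \<open>b = \<zeta> * a\<close> and \<open>1 - b = \<xi> * (1 - a)\<close> with \<open>p\<close>-th
  roots of unity, and each admissible pair determines \<open>a\<close>.\<close>

lemma finite_multiple_points:
  assumes "p > 0"
  shows "finite {a. \<exists>b. b \<noteq> a \<and> param_X p b = param_X p a \<and> param_Y p b = param_Y p a}"
proof (rule finite_subset)
  let ?U = "{z :: complex. z ^ p = 1}"
  show "finite ((\<lambda>(\<zeta>, \<xi>). (1 - \<xi>) / (\<zeta> - \<xi>)) ` (?U \<times> ?U))"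
    using assms by (intro finite_imageI finite_cartesian_product finite_roots_unity) simp_all
  show "{a. \<exists>b. b \<noteq> a \<and> param_X p b = param_X p a \<and> param_Y p b = param_Y p a}
    \<subseteq> (\<lambda>(\<zeta>, \<xi>). (1 - \<xi>) / (\<zeta> - \<xi>)) ` (?U \<times> ?U)"
  proof
    fix a assume "a \<in> {a. \<exists>b. b \<noteq> a \<and> param_X p b = param_X p a \<and> param_Y p b = param_Y p a}"
    then obtain b where "b \<noteq> a" and pow: "b ^ p = a ^ p" "(1 - b) ^ p = (1 - a) ^ p"
      by (auto simp: param_X_def param_Y_def eps_def)
    \<comment> \<open>If \<open>a\<close> were 0 or 1, a vanishing \<open>p\<close>-th power would
      force \<open>b = a\<close>.\<close>
    have "a \<noteq> 0" "a \<noteq> 1"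
      using \<open>b \<noteq> a\<close> pow assms by (auto simp: power_0_left)
    define \<zeta> \<xi> where "\<zeta> = b / a" and "\<xi> = (1 - b) / (1 - a)"
    have mem: "\<zeta> \<in> ?U" "\<xi> \<in> ?U"
      using pow \<open>a \<noteq> 0\<close> \<open>a \<noteq> 1\<close> by (simp_all add: \<zeta>_def \<xi>_def power_divide)
    have b: "b = \<zeta> * a" "1 - b = \<xi> * (1 - a)"
      using \<open>a \<noteq> 0\<close> \<open>a \<noteq> 1\<close> by (simp_all add: \<zeta>_def \<xi>_def)
    then have eq: "(\<zeta> - \<xi>) * a = 1 - \<xi>"
      by (simp add: algebra_simps)
    \<comment> \<open>Equality would make both roots 1 by \<open>eq\<close>, hence
      \<open>b = a\<close>.\<close>
    have "\<zeta> \<noteq> \<xi>"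
      using eq b \<open>b \<noteq> a\<close> by auto
    then have "a = (1 - \<xi>) / (\<zeta> - \<xi>)"
      using eq by (simp add: field_simps)
    with mem show "a \<in> (\<lambda>(\<zeta>, \<xi>). (1 - \<xi>) / (\<zeta> - \<xi>)) ` (?U \<times> ?U)"
      by (intro image_eqI[of _ _ "(\<zeta>, \<xi>)"]) simp_all
  qed
qed

theorem mainTheorem7:
  fixes p :: nat
  assumes "p \<ge> 2"
  shows
    "affine_curve p = range (\<lambda>a. (param_X p a, param_Y p a))
   \<and> finite {a. \<exists>b. b \<noteq> a \<and> param_X p b = param_X p a \<and> param_Y p b = param_Y p a}
   \<and> (\<forall>x y. hpoint (vector [-1, x, y]) \<in> projective_curve p \<longleftrightarrow> (x, y) \<in> affine_curve p)
   \<and> (\<forall>s t. (s, t) \<noteq> (0, 0) \<longrightarrow>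
        hom_param p (hpoint (vector [s, t]))
          = hpoint (vector [- ((s + t) ^ p), eps p * s ^ p, eps p * t ^ p]))
   \<and> (\<forall>s t a. s + t \<noteq> 0 \<and> a = s / (s + t) \<longrightarrow>
        hom_param p (hpoint (vector [s, t]))
          = hpoint (vector [-1, param_X p a, param_Y p a]))
   \<and> projective_curve p = range (hom_param p)
   \<and> (\<exists>h :: (2 proj \<Rightarrow> 2 proj) \<Rightarrow> 3 perm.
        bij_betw h anharmonic UNIV
        \<and> (\<forall>g\<in>anharmonic. \<forall>g'\<in>anharmonic. g \<circ> g' \<in> anharmonic \<and> h (g \<circ> g') = h g * h g')
        \<and> (\<forall>g\<in>anharmonic. \<forall>Q. hom_param p (g Q) = permute_coords (h g) (hom_param p Q)))
   \<and> (\<forall>\<sigma> \<tau>. (\<forall>P\<in>projective_curve p. permute_coords \<sigma> P = permute_coords \<tau> P) \<longrightarrow> \<sigma> = \<tau>)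
   \<and> (\<forall>\<sigma>. permute_coords \<sigma> ` projective_curve p = projective_curve p)"
proof (intro conjI allI impI)
  have p: "p > 0" using assms by simp
  have vec_nz: "(vector [- 1, x, y] :: complex ^ 3) \<noteq> 0" for x y
    by (auto simp: Finite_Cartesian_Product.vec_eq_iff forall_3)
  show "affine_curve p = range (\<lambda>a. (param_X p a, param_Y p a))"
    by (rule affine_curve_eq_range[OF p])
  show "finite {a. \<exists>b. b \<noteq> a \<and> param_X p b = param_X p a \<and> param_Y p b = param_Y p a}"
    by (rule finite_multiple_points[OF p])
  show "hpoint (vector [-1, x, y]) \<in> projective_curve p \<longleftrightarrow> (x, y) \<in> affine_curve p" for x y
    by (simp add: hpoint_in_projective_curve_iff vec_nz homogenization_chart affine_curve_def)
  show param: "hom_param p (hpoint (vector [s, t]))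
      = hpoint (vector [- ((s + t) ^ p), eps p * s ^ p, eps p * t ^ p])"
    if "(s, t) \<noteq> (0, 0)" for s t
  proof -
    have "(vector [s, t] :: complex ^ 2) \<noteq> 0"
      using that by (auto simp: Finite_Cartesian_Product.vec_eq_iff forall_2)
    then show ?thesis by (simp add: hom_param_hpoint hom_param_coords_def)
  qed
  show "hom_param p (hpoint (vector [s, t])) = hpoint (vector [-1, param_X p a, param_Y p a])"
    if "s + t \<noteq> 0 \<and> a = s / (s + t)" for s t a
  proof -
    let ?v = "vector [-1, param_X p a, param_Y p a] :: complex ^ 3"
    from that have sum: "s + t \<noteq> 0" and a: "a = s / (s + t)" by auto
    have "1 - a = t / (s + t)" using sum by (simp add: a field_simps)
    then have "vector [- ((s + t) ^ p), eps p * s ^ p, eps p * t ^ p] = (s + t) ^ p *s ?v"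
      using sum by (simp add: a param_X_def param_Y_def power_divide Finite_Cartesian_Product.vec_eq_iff forall_3)
    moreover have "hpoint ?v = hpoint ((s + t) ^ p *s ?v)"
      using sum vec_nz by (subst hpoint_eq_iff) (auto simp: vector_mul_eq_0)
    moreover have "(s, t) \<noteq> (0, 0)" using sum by auto
    ultimately show ?thesis by (simp add: param)
  qed
  show curve: "projective_curve p = range (hom_param p)"
    by (rule projective_curve_eq_range[OF p])
  have bij: "bij_betw permute_line UNIV anharmonic"
    by (simp add: bij_betw_def inj_permute_line range_permute_line)
  \<comment> \<open>\<open>permute_line\<close> is a group isomorphism onto
    \<open>anharmonic\<close>; its inverse is the required map.\<close>
  let ?h = "inv_into UNIV permute_line"
  have h: "permute_line (?h g) = g" if "g \<in> anharmonic" for g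
    using that range_permute_line by (metis f_inv_into_f)
  have "bij_betw ?h anharmonic UNIV"
    using bij_betw_inv_into[OF bij] .
  moreover have "g \<circ> g' \<in> anharmonic \<and> ?h (g \<circ> g') = ?h g * ?h g'"
    if "g \<in> anharmonic" "g' \<in> anharmonic" for g g'
  proof -
    have "permute_line (?h g * ?h g') = g \<circ> g'"
      using that by (simp add: permute_line_times h)
    then show ?thesis
      by (metis inj_permute_line inv_f_f permute_line_in_anharmonic)
  qed
  moreover have "hom_param p (g Q) = permute_coords (?h g) (hom_param p Q)" if "g \<in> anharmonic" for g Q
    using hom_param_permute_line[OF p, of "?h g" Q] by (simp add: h that)
  ultimately show "\<exists>h :: (2 proj \<Rightarrow> 2 proj) \<Rightarrow> 3 perm.
        bij_betw h anharmonic UNIV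
        \<and> (\<forall>g\<in>anharmonic. \<forall>g'\<in>anharmonic. g \<circ> g' \<in> anharmonic \<and> h (g \<circ> g') = h g * h g')
        \<and> (\<forall>g\<in>anharmonic. \<forall>Q. hom_param p (g Q) = permute_coords (h g) (hom_param p Q))"
    by blast
  show "\<sigma> = \<tau>" if "\<forall>P\<in>projective_curve p. permute_coords \<sigma> P = permute_coords \<tau> P" for \<sigma> \<tau>
    using that by (intro permute_coords_faithful_on_hom_param[OF p]) (simp add: curve)
  show "permute_coords \<sigma> ` projective_curve p = projective_curve p" for \<sigma>
  proof -
    \<comment> \<open>Equivariance moves the permutation to the parameter line, where it is
      surjective.\<close>
    have "permute_coords \<sigma> ` range (hom_param p) = hom_param p ` range (permute_line \<sigma>)"
      by (simp add: image_image hom_param_permute_line[OF p])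
    then show ?thesis by (simp add: curve surj_permute_line)
  qed
qed

end
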